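(* Let $H$ be a subgroup of a finite group $G$. Then \[ \Pr(H, G) \geq \frac{1}{|K(G, H)|}\left(1 + \frac{|K(G, H)| - 1}{|H:Z(H, G)|}\right). \] In particular, if $Z(H, G) \ne H$ then $\Pr(H, G) > \frac{1}{|K(G, H)|}$.
   Context: For a finite group $G$ and a subgroup $H$ of $G$: $[x,y] := xyx^{-1}y^{-1}$ denotes the commutator of $x,y \in G$; $Z(H,G) := \{h \in H : hg = gh \text{ for all } g \in G\} = Z(G)\cap H$, where $Z(G)$ is the center of $G$; $K(G,H) := \{[x,y] : x \in G,\ y \in H\}$ is the set (not the generated subgroup) of such commutators, and $|K(G,H)|$ is its cardinality. The relative commutativity degree is the probability that an element of $G$ commutes with an element of $H$: \[ \Pr(H,G) := \frac{|\{(x,y) \in H\times G : xy = yx\}|}{|H||G|}. \] *)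

theory Defs
  imports Complex_Main "HOL-Algebra.Coset"
begin

definition commutator :: "('a, 'b) monoid_scheme \<Rightarrow> 'a \<Rightarrow> 'a \<Rightarrow> 'a" where
  "commutator G x y = x \<otimes>\<^bsub>G\<^esub> y \<otimes>\<^bsub>G\<^esub> inv\<^bsub>G\<^esub> x \<otimes>\<^bsub>G\<^esub> inv\<^bsub>G\<^esub> y"

definition rel_center :: "('a, 'b) monoid_scheme \<Rightarrow> 'a set \<Rightarrow> 'a set" where
  "rel_center G H = {h \<in> H. \<forall>g \<in> carrier G. h \<otimes>\<^bsub>G\<^esub> g = g \<otimes>\<^bsub>G\<^esub> h}"

(* The set of commutators, not the subgroup it generates. *)
definition commutator_set :: "('a, 'b) monoid_scheme \<Rightarrow> 'a set \<Rightarrow> 'a set" where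
  "commutator_set G H = {commutator G x y | x y. x \<in> carrier G \<and> y \<in> H}"

definition rel_comm_degree :: "('a, 'b) monoid_scheme \<Rightarrow> 'a set \<Rightarrow> real" where
  "rel_comm_degree G H =
     real (card {(x, y) \<in> H \<times> carrier G. x \<otimes>\<^bsub>G\<^esub> y = y \<otimes>\<^bsub>G\<^esub> x})
       / (real (card H) * real (order G))"

(* Defined inside the group H, so that only the cosets of K contained in H are counted. *)
definition subgroup_index :: "('a, 'b) monoid_scheme \<Rightarrow> 'a set \<Rightarrow> 'a set \<Rightarrow> nat" where
  "subgroup_index G H K = card (rcosets\<^bsub>G\<lparr>carrier := H\<rparr>\<^esub> K)"

end

theory Submission
  imports Defs
begin

text \<open>
  Counting the commuting pairs row by row turns the relative commutativity degree into the average
  over \<open>h \<in> H\<close> of \<open>\<bar>C(h)\<bar> / \<bar>G\<bar>\<close>, where \<open>C(h)\<close> is the centralizer of \<open>h\<close> in \<open>G\<close>. An element of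
  the relative center contributes \<open>1\<close>. Any other element contributes at least \<open>1 / \<bar>K(G, H)\<bar>\<close>,
  because \<open>\<bar>G\<bar> / \<bar>C(h)\<bar>\<close> is the number of conjugates of \<open>h\<close>, and \<open>x h x\<inverse> = [x, h] h\<close> makes this
  the number of commutators \<open>[x, h]\<close> with \<open>h\<close> fixed, which all lie in \<open>K(G, H)\<close> (lemma
  \<open>order_le_centralizer_times_commutators\<close>). By Lagrange's theorem the relative center
  makes up the proportion \<open>1 / \<bar>H : Z(H, G)\<bar>\<close> of \<open>H\<close>, so with \<open>k = \<bar>K(G, H)\<bar>\<close> and
  \<open>m = \<bar>H : Z(H, G)\<bar>\<close> the average is at least \<open>1/m + (1 - 1/m)/k\<close>, which is the claimed bound.
  It exceeds \<open>1/k\<close> as soon as \<open>k > 1\<close>, that is, as soon as some element of \<open>H\<close> is not central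
  in \<open>G\<close>.
\<close>

definition centralizer :: "('a, 'b) monoid_scheme \<Rightarrow> 'a \<Rightarrow> 'a set" where
  "centralizer G h = {g \<in> carrier G. h \<otimes>\<^bsub>G\<^esub> g = g \<otimes>\<^bsub>G\<^esub> h}"

lemma (in group) commutator_eq_one_iff:
  assumes "x \<in> carrier G" "y \<in> carrier G"
  shows "commutator G x y = \<one> \<longleftrightarrow> x \<otimes> y = y \<otimes> x"
proof -
  have "commutator G x y = (x \<otimes> y) \<otimes> inv (y \<otimes> x)"
    using assms by (simp add: commutator_def inv_mult_group m_assoc)
  then show ?thesis
    using assms by (metis inv_solve_right l_one m_closed one_closed)
qed

text \<open>
  Cancelling \<open>h\<inverse>\<close> in \<open>[x, h] = [y, h]\<close> leaves equal conjugates \<open>x h x\<inverse> = y h y\<inverse>\<close>: the fibres of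
  \<open>x \<mapsto> [x, h]\<close> lie in left cosets of the centralizer of \<open>h\<close>.
\<close>

lemma (in group) commutator_eq_imp_centralizer:
  assumes x: "x \<in> carrier G" and y: "y \<in> carrier G" and h: "h \<in> carrier G"
    and eq: "commutator G x h = commutator G y h"
  shows "inv x \<otimes> y \<in> centralizer G h"
proof -
  have "x \<otimes> h \<otimes> inv x = y \<otimes> h \<otimes> inv y"
    using eq x y h by (simp add: commutator_def)
  then have "inv x \<otimes> (x \<otimes> h \<otimes> inv x) \<otimes> y = inv x \<otimes> (y \<otimes> h \<otimes> inv y) \<otimes> y"
    by simp
  moreover have "inv x \<otimes> (x \<otimes> h \<otimes> inv x) \<otimes> y = h \<otimes> (inv x \<otimes> y)"
    using x y h by (simp add: m_assoc inv_solve_left')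
  moreover have "inv x \<otimes> (y \<otimes> h \<otimes> inv y) \<otimes> y = inv x \<otimes> y \<otimes> h"
    using x y h by (simp add: m_assoc)
  ultimately show ?thesis
    using x y by (simp add: centralizer_def)
qed

text \<open>
  The fibres of \<open>x \<mapsto> [x, h]\<close> over the commutators in \<open>K(G, H)\<close> cover \<open>G\<close>, and none of them has more
  elements than the centralizer of \<open>h\<close>.
\<close>

lemma (in group) order_le_centralizer_times_commutators:
  assumes fin: "finite (carrier G)" and sub: "H \<subseteq> carrier G" and h: "h \<in> H"
  shows "order G \<le> card (centralizer G h) * card (commutator_set G H)"
proof -
  let ?K = "commutator_set G H"
  let ?F = "\<lambda>c. {x \<in> carrier G. commutator G x h = c}"
  have hG: "h \<in> carrier G" using h sub by blast
  have finC: "finite (centralizer G h)" using fin by (simp add: centralizer_def)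
  have fibre: "card (?F c) \<le> card (centralizer G h)" for c
  proof (cases "?F c = {}")
    case False
    then obtain a where a: "a \<in> carrier G" "commutator G a h = c" by blast
    show ?thesis
    proof (rule card_inj_on_le[OF _ _ finC])
      show "inj_on (\<lambda>x. inv a \<otimes> x) (?F c)"
        using a by (auto intro!: inj_onI)
      show "(\<lambda>x. inv a \<otimes> x) ` ?F c \<subseteq> centralizer G h"
        using a hG commutator_eq_imp_centralizer by force
    qed
  next
    case True
    then show ?thesis by (metis card.empty zero_le)
  qed
  have "?K = (\<lambda>(x, y). commutator G x y) ` (carrier G \<times> H)"
    by (auto simp: commutator_set_def)
  then have finK: "finite ?K"
    using fin finite_subset[OF sub fin] by simp
  have "carrier G = (\<Union>c\<in>?K. ?F c)"
    using h by (auto simp: commutator_set_def)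
  then have "order G \<le> (\<Sum>c\<in>?K. card (?F c))"
    using card_UN_le[OF finK, of ?F] by (simp add: order_def)
  also have "\<dots> \<le> (\<Sum>c\<in>?K. card (centralizer G h))"
    by (rule sum_mono) (rule fibre)
  finally show ?thesis by (simp add: mult.commute)
qed

lemma (in group) subgroup_rel_center:
  assumes "subgroup H G"
  shows "subgroup (rel_center G H) G"
proof
  have sub: "H \<subseteq> carrier G" using assms by (rule subgroup.subset)
  show "rel_center G H \<subseteq> carrier G" using sub by (auto simp: rel_center_def)
  show "\<one> \<in> rel_center G H"
    using assms by (auto simp: rel_center_def subgroup.one_closed)
  show "x \<otimes> y \<in> rel_center G H" if "x \<in> rel_center G H" "y \<in> rel_center G H" for x y
  proof -
    have "x \<otimes> y \<otimes> g = g \<otimes> (x \<otimes> y)" if g: "g \<in> carrier G" for g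
    proof -
      have "x \<in> carrier G" "y \<in> carrier G" "x \<otimes> g = g \<otimes> x" "y \<otimes> g = g \<otimes> y"
        using \<open>x \<in> rel_center G H\<close> \<open>y \<in> rel_center G H\<close> sub g by (auto simp: rel_center_def)
      then show ?thesis using g by (metis m_assoc)
    qed
    then show ?thesis
      using that assms by (auto simp: rel_center_def subgroup.m_closed)
  qed
  show "inv x \<in> rel_center G H" if "x \<in> rel_center G H" for x
  proof -
    have "inv x \<otimes> g = g \<otimes> inv x" if g: "g \<in> carrier G" for g
    proof -
      have "x \<in> carrier G" "x \<otimes> g = g \<otimes> x"
        using \<open>x \<in> rel_center G H\<close> sub g by (auto simp: rel_center_def)
      then show ?thesis
        using g by (metis inv_closed inv_solve_left inv_solve_right m_assoc m_closed)
    qed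
    then show ?thesis
      using that assms by (auto simp: rel_center_def subgroup.m_inv_closed)
  qed
qed

lemma (in group) subgroup_index_times_card_rel_center:
  assumes "subgroup H G"
  shows "subgroup_index G H (rel_center G H) * card (rel_center G H) = card H"
proof -
  interpret K: group "G\<lparr>carrier := H\<rparr>"
    using assms by (rule subgroup_imp_group)
  have "subgroup (rel_center G H) (G\<lparr>carrier := H\<rparr>)"
    using subgroup_incl[OF subgroup_rel_center[OF assms] assms]
    by (auto simp: rel_center_def)
  then show ?thesis
    using K.lagrange by (simp add: subgroup_index_def order_def)
qed

lemma card_commuting_pairs:
  assumes "finite (carrier G)" "finite H"
  shows "card {(x, y) \<in> H \<times> carrier G. x \<otimes>\<^bsub>G\<^esub> y = y \<otimes>\<^bsub>G\<^esub> x} = (\<Sum>h\<in>H. card (centralizer G h))"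
proof -
  have "{(x, y) \<in> H \<times> carrier G. x \<otimes>\<^bsub>G\<^esub> y = y \<otimes>\<^bsub>G\<^esub> x} = Sigma H (centralizer G)"
    by (auto simp: centralizer_def)
  then show ?thesis
    using assms by (simp add: centralizer_def)
qed

text \<open>
  A noncentral \<open>h \<in> H\<close> fails to commute with some \<open>g\<close>, which gives the nontrivial commutator \<open>[g, h]\<close>
  in addition to \<open>[\<one>, \<one>] = \<one>\<close>.
\<close>

lemma (in group) one_less_card_commutator_set:
  assumes fin: "finite (carrier G)" and H: "subgroup H G" and ne: "rel_center G H \<noteq> H"
  shows "1 < card (commutator_set G H)"
proof -
  have sub: "H \<subseteq> carrier G" using H by (rule subgroup.subset)
  obtain h g where hg: "h \<in> H" "g \<in> carrier G" "h \<otimes> g \<noteq> g \<otimes> h"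
    using ne by (auto simp: rel_center_def)
  have "commutator G g h \<noteq> \<one>"
    using hg sub commutator_eq_one_iff[of g h] by auto
  moreover have "commutator G \<one> \<one> = \<one>"
    using commutator_eq_one_iff by blast
  moreover have "commutator G g h \<in> commutator_set G H" "commutator G \<one> \<one> \<in> commutator_set G H"
    using hg subgroup.one_closed[OF H] by (auto simp: commutator_set_def)
  moreover have "commutator_set G H = (\<lambda>(x, y). commutator G x y) ` (carrier G \<times> H)"
    by (auto simp: commutator_set_def)
  then have "finite (commutator_set G H)"
    using fin finite_subset[OF sub fin] by simp
  ultimately show ?thesis
    by (metis card_le_Suc0_iff_eq One_nat_def not_le)
qed

theorem theoremA:
  fixes G :: "('a, 'b) monoid_scheme" and H :: "'a set"
  assumes "group G" and "finite (carrier G)" and "subgroup H G"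
  shows "rel_comm_degree G H \<ge>
           1 / real (card (commutator_set G H)) *
             (1 + (real (card (commutator_set G H)) - 1)
                    / real (subgroup_index G H (rel_center G H)))
       \<and> (rel_center G H \<noteq> H \<longrightarrow>
            rel_comm_degree G H > 1 / real (card (commutator_set G H)))"
proof -
  interpret group G by fact
  let ?Z = "rel_center G H"
  define k n m z N where "k = real (card (commutator_set G H))" and "n = real (card H)"
    and "m = real (subgroup_index G H ?Z)" and "z = real (card ?Z)" and "N = real (order G)"
  have sub: "H \<subseteq> carrier G" using assms(3) by (rule subgroup.subset)
  have finH: "finite H" using finite_subset[OF sub assms(2)] .
  have ZH: "?Z \<subseteq> H" by (auto simp: rel_center_def)
  have oneH: "\<one>\<^bsub>G\<^esub> \<in> H" using assms(3) by (rule subgroup.one_closed)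
  have N: "N > 0" using assms(2) order_gt_0_iff_finite by (simp add: N_def)
  have n: "n > 0" using finH oneH by (auto simp: n_def card_gt_0_iff)
  have index: "m * z = n"
    using subgroup_index_times_card_rel_center[OF assms(3)]
    by (simp add: m_def z_def n_def flip: of_nat_mult)
  then have mz: "m > 0" "z > 0"
    using n by (auto simp: m_def z_def zero_less_mult_iff)
  have le: "N \<le> real (card (centralizer G h)) * k" if "h \<in> H" for h
    using order_le_centralizer_times_commutators[OF assms(2) sub that]
    unfolding N_def k_def by (simp flip: of_nat_mult)
  have k: "k > 0" using le[OF oneH] N by (cases "k = 0") (auto simp: k_def)
  have central: "real (card (centralizer G h)) = N" if "h \<in> ?Z" for h
  proof -
    have "centralizer G h = carrier G" using that by (auto simp: centralizer_def rel_center_def)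
    then show ?thesis by (simp add: N_def order_def)
  qed
  have card_diff: "real (card (H - ?Z)) = n - z"
    using ZH finH by (simp add: n_def z_def card_Diff_subset finite_subset card_mono of_nat_diff)
  have "z * N + (n - z) * (N / k) = (\<Sum>h\<in>?Z. N) + (\<Sum>h\<in>H - ?Z. N / k)"
    by (simp add: card_diff z_def)
  also have "\<dots> \<le> (\<Sum>h\<in>?Z. real (card (centralizer G h)))
                  + (\<Sum>h\<in>H - ?Z. real (card (centralizer G h)))"
    using central le k by (intro add_mono sum_mono) (auto simp: divide_le_eq)
  also have "\<dots> = (\<Sum>h\<in>H. real (card (centralizer G h)))"
    using sum.subset_diff[OF ZH finH, of "\<lambda>h. real (card (centralizer G h))"] by simp
  also have "\<dots> = rel_comm_degree G H * (n * N)"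
    using n N card_commuting_pairs[OF assms(2) finH]
    by (simp add: rel_comm_degree_def n_def N_def)
  finally have "z * N + (n - z) * (N / k) \<le> rel_comm_degree G H * (n * N)" .
  moreover have "z * N + (n - z) * (N / k) = (1 / k * (1 + (k - 1) / m)) * (n * N)"
    using mz k N by (simp add: field_simps flip: index)
  ultimately have "1 / k * (1 + (k - 1) / m) * (n * N) \<le> rel_comm_degree G H * (n * N)"
    by (simp only:)
  then have bound: "1 / k * (1 + (k - 1) / m) \<le> rel_comm_degree G H"
    by (rule mult_right_le_imp_le) (use n N in simp)
  moreover have "1 / k < rel_comm_degree G H" if "?Z \<noteq> H"
  proof -
    have "k > 1"
      using one_less_card_commutator_set[OF assms(2,3) that] by (simp add: k_def)
    then have "1 / k * 1 < 1 / k * (1 + (k - 1) / m)"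
      using mz k by (intro mult_strict_left_mono) auto
    then show ?thesis using bound by simp
  qed
  ultimately show ?thesis unfolding k_def m_def by blast
qed

end
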